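(* Let $k\ge1$ and $a\in\{1,\dots,k\}$. Let $p_1$ be the partially ordered pattern of length $k$ whose poset on $\{1,\dots,k\}$ has relations exactly $j<a$ for all $j\ne a$ (all other pairs incomparable), and let $p_2$ be the partially ordered pattern of length $k$ whose poset has relations exactly $k<j$ for all $j\in\{1,\dots,k-1\}$ (all other pairs incomparable). Then $p_1$ and $p_2$ are shape-Wilf-equivalent.
   Context: A partially ordered pattern (POP) $p$ of length $k$ is a partial order $P$ on $\{1,\dots,k\}$. An occurrence of $p$ in a permutation $\pi_1\cdots\pi_n$ is a subsequence $\pi_{i_1}\cdots\pi_{i_k}$ ($i_1<\dots<i_k$) such that $\pi_{i_j}<\pi_{i_m}$ whenever $j<m$ in $P$. Equivalently, avoiding $p$ means avoiding every classical pattern $q\in S_k$ with $q_j<q_m$ whenever $j<_P m$; avoidance of a POP in a filling means avoidance of all these classical patterns. A Ferrers board is a finite bottom-left-justified array of unit squares in which the number of squares in each row is at most the number in the row below (a set $F$ of cells $(i,j)$, column $i$, row $j$, closed under decreasing either coordinate). A filling of $F$ assigns $0$'s and $1$'s to its cells so that every row and every column of $F$ has exactly one $1$. A filling contains a classical pattern $q$ of length $k$ if there are columns $c_1<\dots<c_k$ and rows $r_1<\dots<r_k$ with all cells $(c_a,r_b)$ in $F$ such that the filling restricted to these cells has a $1$ at $(c_a,r_b)$ exactly when $q_a=b$. Two (sets of) patterns are shape-Wilf-equivalent if for every Ferrers board $F$ the numbers of fillings of $F$ avoiding them are equal. *)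

theory Defs
  imports Main "HOL-Library.FuncSet" "HOL-Combinatorics.Permutations"
begin

text \<open>A cell is a pair (column, row), counted from the bottom-left corner, starting with 1.\<close>

definition ferrers_board :: "(nat \<times> nat) set \<Rightarrow> bool" where
  "ferrers_board F \<longleftrightarrow> finite F \<and> (\<forall>(i, j)\<in>F. 1 \<le> i \<and> 1 \<le> j) \<and>
     (\<forall>i j i' j'. (i, j) \<in> F \<and> 1 \<le> i' \<and> i' \<le> i \<and> 1 \<le> j' \<and> j' \<le> j \<longrightarrow> (i', j') \<in> F)"

text \<open>Fillings are extensional functions on the board, so that each filling is counted once.
  The columns and rows of \<open>F\<close> are the nonempty ones.\<close>

definition fillings :: "(nat \<times> nat) set \<Rightarrow> (nat \<times> nat \<Rightarrow> nat) set" where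
  "fillings F = {f \<in> F \<rightarrow>\<^sub>E {0, 1}.
     (\<forall>i \<in> fst ` F. \<exists>!j. (i, j) \<in> F \<and> f (i, j) = 1) \<and>
     (\<forall>j \<in> snd ` F. \<exists>!i. (i, j) \<in> F \<and> f (i, j) = 1)}"

text \<open>A pair \<open>(k, q)\<close> with \<open>q permutes {1..k}\<close> is the classical pattern \<open>q 1 \<dots> q k\<close> of length \<open>k\<close>.\<close>

type_synonym pattern = "nat \<times> (nat \<Rightarrow> nat)"

definition filling_contains :: "(nat \<times> nat) set \<Rightarrow> (nat \<times> nat \<Rightarrow> nat) \<Rightarrow> pattern \<Rightarrow> bool" where
  "filling_contains F f = (\<lambda>(k, q). \<exists>c r :: nat \<Rightarrow> nat.
     strict_mono_on {1..k} c \<and> strict_mono_on {1..k} r \<and>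
     (\<forall>a\<in>{1..k}. \<forall>b\<in>{1..k}. (c a, r b) \<in> F \<and> (f (c a, r b) = 1 \<longleftrightarrow> q a = b)))"

definition avoiding_fillings ::
  "(nat \<times> nat) set \<Rightarrow> pattern set \<Rightarrow> (nat \<times> nat \<Rightarrow> nat) set" where
  "avoiding_fillings F Q = {f \<in> fillings F. \<forall>q\<in>Q. \<not> filling_contains F f q}"

definition shape_Wilf_equivalent :: "pattern set \<Rightarrow> pattern set \<Rightarrow> bool" where
  "shape_Wilf_equivalent Q Q' \<longleftrightarrow>
     (\<forall>F. ferrers_board F \<longrightarrow> card (avoiding_fillings F Q) = card (avoiding_fillings F Q'))"

text \<open>A partially ordered pattern of length \<open>k\<close> is given by the strict part \<open>P\<close> of a partial order
  on \<open>{1..k}\<close>. In a filling it stands for the set of the following classical patterns.\<close>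

definition is_pop :: "nat \<Rightarrow> nat rel \<Rightarrow> bool" where
  "is_pop k P \<longleftrightarrow> P \<subseteq> {1..k} \<times> {1..k} \<and> irrefl P \<and> trans P"

definition pop_patterns :: "nat \<Rightarrow> nat rel \<Rightarrow> pattern set" where
  "pop_patterns k P = {(k, q) | q. q permutes {1..k} \<and> (\<forall>(j, m)\<in>P. q j < q m)}"

definition pop1 :: "nat \<Rightarrow> nat \<Rightarrow> nat rel" where
  "pop1 k a = {(j, a) | j. j \<in> {1..k} \<and> j \<noteq> a}"

definition pop2 :: "nat \<Rightarrow> nat rel" where
  "pop2 k = {(k, j) | j. j \<in> {1..k - 1}}"

lemma is_pop_pop1: "a \<in> {1..k} \<Longrightarrow> is_pop k (pop1 k a)"
  by (auto simp: is_pop_def pop1_def irrefl_def intro!: transI)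

lemma is_pop_pop2: "is_pop k (pop2 k)"
  by (auto simp: is_pop_def pop2_def irrefl_def intro!: transI)

end

theory Submission
  imports Defs "HOL-Library.Infinite_Set"
begin

text \<open>
  Place the ones of a filling row by row, starting at the top. When row \<open>r\<close> of length \<open>l\<close> on a
  board with \<open>n\<close> rows and columns is reached, the \<open>n - r\<close> rows above occupy columns that also meet
  row \<open>r\<close>, so \<open>m = l + r - n\<close> columns are free, and all of these but the chosen one receive their one
  below row \<open>r\<close>. Hence row \<open>r\<close> is the top row of an occurrence of the first pattern exactly when at
  least \<open>a - 1\<close> free columns lie to the left and at least \<open>k - a\<close> to the right of the chosen one,
  which leaves \<open>min m (k - 1)\<close> good choices, independently of \<open>a\<close> and of the earlier choices.
  Transposing the board turns the second pattern into the first one with \<open>a = 1\<close>. It remains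
  to see that a board and its transpose have the same multiset of values \<open>l + r\<close>.
\<close>

section \<open>Counting choices and enumerating finite sets of naturals\<close>

text \<open>Only the rank of \<open>c\<close> in \<open>X\<close> matters. Ranks run bijectively
  through \<open>0, ..., card X - 1\<close>, and the ranks with enough elements on both sides form
  an interval with \<open>card X - (k - 1)\<close> elements, in truncated subtraction. Hence the
  count does not depend on \<open>a\<close>.\<close>

lemma card_extreme_positions:
  fixes X :: "'a::linorder set"
  assumes fin: "finite X" and "1 \<le> a" "a \<le> k"
  shows "card {c \<in> X. \<not> (a - 1 \<le> card {x \<in> X. x < c} \<and> k - a \<le> card {x \<in> X. c < x})}
         = min (card X) (k - 1)"
proof -
  define rk where "rk c = card {x \<in> X. x < c}" for c
  have less: "rk c < rk d" if "c \<in> X" "c < d" for c d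
    unfolding rk_def using that fin by (intro psubset_card_mono) auto
  have inj: "inj_on rk X"
    by (rule linorder_inj_onI) (auto dest: less)
  have split: "card {x \<in> X. c < x} + rk c + 1 = card X" if "c \<in> X" for c
  proof -
    have "X = {x \<in> X. c < x} \<union> insert c {x \<in> X. x < c}" using that by auto
    then have "card X = card ({x \<in> X. c < x} \<union> insert c {x \<in> X. x < c})" by simp
    also have "\<dots> = card {x \<in> X. c < x} + card (insert c {x \<in> X. x < c})"
      using fin by (intro card_Un_disjoint) auto
    also have "card (insert c {x \<in> X. x < c}) = rk c + 1"
      using fin by (simp add: rk_def)
    finally show ?thesis by simp
  qed
  have img: "rk ` X = {..<card X}"
  proof (rule card_subset_eq)
    show "rk ` X \<subseteq> {..<card X}" using split by force
    show "card (rk ` X) = card {..<card X}" by (simp add: card_image inj)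
  qed simp
  let ?B = "{c \<in> X. \<not> (a - 1 \<le> card {x \<in> X. x < c} \<and> k - a \<le> card {x \<in> X. c < x})}"
  have "rk ` ?B = {s \<in> rk ` X. \<not> (a - 1 \<le> s \<and> k - a + s + 1 \<le> card X)}"
  proof -
    have "a - 1 \<le> card {x \<in> X. x < c} \<and> k - a \<le> card {x \<in> X. c < x} \<longleftrightarrow>
        a - 1 \<le> rk c \<and> k - a + rk c + 1 \<le> card X" if "c \<in> X" for c
      using split[OF that] by (auto simp: rk_def)
    then show ?thesis by blast
  qed
  \<comment> \<open>The second condition \<open>k - a + s + 1 \<le> card X\<close> is an upper bound
    on the rank \<open>s\<close>, also when the subtraction truncates to 0.\<close>
  also have "\<dots> = {..<card X} - {a - 1..<card X - (k - a)}"
    unfolding img by auto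
  finally have "card (rk ` ?B) = card ({..<card X} - {a - 1..<card X - (k - a)})"
    by simp
  also have "\<dots> = card X - card {a - 1..<card X - (k - a)}"
    by (subst card_Diff_subset) auto
  also have "\<dots> = min (card X) (k - 1)"
    using assms by (auto simp: min_def)
  also have "card (rk ` ?B) = card ?B"
    by (rule card_image) (rule inj_on_subset[OF inj], auto)
  finally show ?thesis .
qed

text \<open>Values are chosen for \<open>n, n - 1, ..., 1\<close> in turn. The options at
  \<open>r\<close> depend on the set of values already used, but their number \<open>w r\<close> is
  the same after every admissible history, so the numbers multiply.\<close>

lemma card_sequential_choice:
  fixes A :: "nat \<Rightarrow> 'a set \<Rightarrow> 'a set" and w :: "nat \<Rightarrow> nat"
  assumes fin: "\<And>r U. r \<in> {1..n} \<Longrightarrow> finite (A r U)"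
    and card: "\<And>r \<sigma>. r \<in> {1..n} \<Longrightarrow> \<forall>s\<in>{r<..n}. \<sigma> s \<in> A s (\<sigma> ` {s<..n}) \<Longrightarrow>
      card (A r (\<sigma> ` {r<..n})) = w r"
  shows "card {\<sigma> \<in> extensional {1..n}. \<forall>r\<in>{1..n}. \<sigma> r \<in> A r (\<sigma> ` {r<..n})} = (\<Prod>r=1..n. w r)"
proof -
  \<comment> \<open>These are the partial choices for the indices above \<open>i\<close>; the
    induction lowers \<open>i\<close> from \<open>n\<close> to 0.\<close>
  define S where
    "S i = {\<sigma> \<in> extensional {i<..n}. \<forall>r\<in>{i<..n}. \<sigma> r \<in> A r (\<sigma> ` {r<..n})}" for i
  have "finite (S (n - i)) \<and> card (S (n - i)) = prod w {n - i<..n}" if "i \<le> n" for i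
    using that
  proof (induction i)
    case 0
    have "S n = {\<lambda>x. undefined}" by (auto simp: S_def)
    then show ?case by simp
  next
    case (Suc i)
    define r where "r = n - i"
    have r: "r \<in> {1..n}" "n - Suc i = r - 1" using Suc.prems by (auto simp: r_def)
    have ins: "{r - 1<..n} = insert r {r<..n}" using r by auto
    have IH: "finite (S r)" "card (S r) = prod w {r<..n}" using Suc by (auto simp: r_def)
    define T where "T = (SIGMA \<tau>:S r. A r (\<tau> ` {r<..n}))"
    define u where "u = (\<lambda>(\<tau>, c). \<tau>(r := c) :: nat \<Rightarrow> 'a)"
    have upd: "(\<tau>(r := c)) ` {s<..n} = \<tau> ` {s<..n}" if "s \<ge> r" for \<tau> :: "nat \<Rightarrow> 'a" and c s
      using that by (intro image_cong) auto
    have inj: "inj_on u T"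
    proof (rule inj_onI)
      fix p q assume "p \<in> T" "q \<in> T" and eq: "u p = u q"
      obtain \<tau> c \<tau>' c' where pq: "p = (\<tau>, c)" "q = (\<tau>', c')" by (cases p, cases q)
      \<comment> \<open>Since the old choice has the default value at \<open>r\<close>, it can be
        recovered from the updated function.\<close>
      have "\<tau> r = undefined" "\<tau>' r = undefined"
        using \<open>p \<in> T\<close> \<open>q \<in> T\<close> by (auto simp: pq T_def S_def extensional_def)
      then show "p = q" using eq unfolding pq u_def
        by (metis (mono_tags, lifting) case_prod_conv fun_upd_same fun_upd_triv fun_upd_upd)
    qed
    have img: "u ` T = S (r - 1)"
    proof (intro equalityI subsetI)
      fix \<sigma> assume "\<sigma> \<in> u ` T"
      then obtain \<tau> c where \<tau>: "\<tau> \<in> S r" "c \<in> A r (\<tau> ` {r<..n})" "\<sigma> = \<tau>(r := c)"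
        by (auto simp: T_def u_def)
      have "\<sigma> s \<in> A s (\<sigma> ` {s<..n})" if "s \<in> {r - 1<..n}" for s
      proof -
        have "\<sigma> ` {s<..n} = \<tau> ` {s<..n}" unfolding \<tau>(3) using that by (intro upd) auto
        moreover have "\<sigma> s \<in> A s (\<tau> ` {s<..n})"
          using that \<tau> by (cases "s = r") (auto simp: S_def)
        ultimately show ?thesis by simp
      qed
      then show "\<sigma> \<in> S (r - 1)"
        using \<tau> r unfolding S_def by (auto simp: extensional_def)
    next
      fix \<sigma> assume \<sigma>: "\<sigma> \<in> S (r - 1)"
      define \<tau> where "\<tau> = \<sigma>(r := undefined)"
      have "\<tau> s \<in> A s (\<tau> ` {s<..n})" if "s \<in> {r<..n}" for s
        using that \<sigma> upd[of s \<sigma> undefined] by (auto simp: S_def \<tau>_def)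
      then have "\<tau> \<in> S r" using \<sigma> unfolding S_def ins by (auto simp: extensional_def \<tau>_def)
      moreover have "\<sigma> r \<in> A r (\<tau> ` {r<..n})"
        using \<sigma> r upd[of r \<sigma> undefined] by (auto simp: S_def \<tau>_def)
      ultimately show "\<sigma> \<in> u ` T"
        by (intro image_eqI[of _ _ "(\<tau>, \<sigma> r)"]) (auto simp: u_def \<tau>_def T_def)
    qed
    have "finite T" unfolding T_def using IH fin r by auto
    then have "finite (S (r - 1))" using img by (metis finite_imageI)
    moreover have "card (S (r - 1)) = card T" using img inj by (metis card_image)
    moreover have "card T = (\<Sum>\<tau>\<in>S r. card (A r (\<tau> ` {r<..n})))"
      unfolding T_def using IH fin r by (intro card_SigmaI) auto
    moreover have "\<dots> = (\<Sum>\<tau>\<in>S r. w r)"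
      using r by (intro sum.cong card) (auto simp: S_def)
    moreover have "\<dots> = prod w {r - 1<..n}"
      unfolding ins using IH by simp
    ultimately show ?case by (simp add: r)
  qed
  from this[of n] have "card (S 0) = prod w {0<..n}" by simp
  moreover have "{0<..n} = {1..n}" by auto
  ultimately show ?thesis unfolding S_def by simp
qed

lemma ex_increasing_enumeration:
  fixes Z :: "nat set"
  assumes "finite Z" "card Z = k"
  obtains e where "strict_mono_on {1..k} e" "bij_betw e {1..k} Z"
proof -
  obtain h where h: "bij_betw h {..<k} Z" "strict_mono_on {..<k} h"
    by (rule ex_bij_betw_strict_mono_card[OF assms(1), unfolded assms(2)])
  show thesis
  proof
    show "strict_mono_on {1..k} (h \<circ> (\<lambda>i. i - 1))"
      using strict_mono_onD[OF h(2), of "i - 1" "j - 1" for i j] by (intro strict_mono_onI) auto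
    have "bij_betw (\<lambda>i. i - 1) {1..k} {..<k}"
      by (rule bij_betwI[where g = Suc]) auto
    then show "bij_betw (h \<circ> (\<lambda>i. i - 1)) {1..k} Z"
      using h(1) by (rule bij_betw_trans)
  qed
qed

lemma downward_closed_eq_atLeastAtMost:
  fixes A :: "nat set"
  assumes "finite A" "0 \<notin> A" and down: "\<And>i j. j \<in> A \<Longrightarrow> 1 \<le> i \<Longrightarrow> i \<le> j \<Longrightarrow> i \<in> A"
  shows "A = {1..card A}"
proof (cases "A = {}")
  case False
  have "A = {1..Max A}"
  proof (intro equalityI subsetI)
    fix x assume "x \<in> A" then show "x \<in> {1..Max A}"
      using assms by (cases x) auto
  next
    fix x assume "x \<in> {1..Max A}" then show "x \<in> A"
      using down[OF Max_in[OF assms(1) False], of x] by auto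
  qed
  moreover from arg_cong[OF this, of card] have "card A = Max A" by simp
  ultimately show ?thesis by simp
qed simp

section \<open>Fillings of a square board as placements\<close>

text \<open>A board that has a filling is of this kind by \<open>square_board_if_fillings\<close>;
  on any other Ferrers board both counts are 0.\<close>

locale square_board =
  fixes F :: "(nat \<times> nat) set" and n :: nat
  assumes ferrers: "ferrers_board F" and cols: "fst ` F = {1..n}" and rows: "snd ` F = {1..n}"
begin

definition row :: "nat \<Rightarrow> nat set" where
  "row r = {i. (i, r) \<in> F}"

text \<open>\<open>\<sigma> r\<close> is the column of the one in row \<open>r\<close>; rows serve
  as indices because they are filled one after another. Extensionality ensures that a filling has
  only one such code.\<close>

definition placements :: "(nat \<Rightarrow> nat) set" where
  "placements = {\<sigma> \<in> extensional {1..n}. bij_betw \<sigma> {1..n} {1..n} \<and> (\<forall>r\<in>{1..n}. \<sigma> r \<in> row r)}"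

definition filling_of :: "(nat \<Rightarrow> nat) \<Rightarrow> nat \<times> nat \<Rightarrow> nat" where
  "filling_of \<sigma> = restrict (\<lambda>(i, j). if \<sigma> j = i then 1 else 0) F"

text \<open>For a placement this set contains \<open>\<sigma> r\<close> itself, and the ones in its
  other columns lie below row \<open>r\<close>.\<close>

definition free :: "(nat \<Rightarrow> nat) \<Rightarrow> nat \<Rightarrow> nat set" where
  "free \<sigma> r = row r - \<sigma> ` {r<..n}"

lemma board_down:
  "(i, j) \<in> F \<Longrightarrow> 1 \<le> i' \<Longrightarrow> i' \<le> i \<Longrightarrow> 1 \<le> j' \<Longrightarrow> j' \<le> j \<Longrightarrow> (i', j') \<in> F"
  using ferrers unfolding ferrers_board_def by blast

lemma board_range: "(i, j) \<in> F \<Longrightarrow> i \<in> {1..n} \<and> j \<in> {1..n}"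
  using imageI[of "(i, j)" F fst] imageI[of "(i, j)" F snd] unfolding cols rows by simp

lemma row_subset: "row r \<subseteq> {1..n}"
  using board_range by (auto simp: row_def)

lemma finite_row: "finite (row r)"
  using row_subset finite_subset by blast

lemma row_antimono:
  assumes "1 \<le> s" "s \<le> r"
  shows "row r \<subseteq> row s"
proof
  fix i assume "i \<in> row r"
  then show "i \<in> row s" using assms board_range[of i r] board_down[of i r i s] by (simp add: row_def)
qed

lemma filling_of_eq_1: "(i, j) \<in> F \<Longrightarrow> filling_of \<sigma> (i, j) = 1 \<longleftrightarrow> \<sigma> j = i"
  by (simp add: filling_of_def)

lemma bij_betw_filling_of: "bij_betw filling_of placements (fillings F)"
proof (rule bij_betw_imageI)
  show "inj_on filling_of placements"
  proof (rule inj_onI)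
    fix \<sigma> \<sigma>' assume *: "\<sigma> \<in> placements" "\<sigma>' \<in> placements" "filling_of \<sigma> = filling_of \<sigma>'"
    have "\<sigma> r = \<sigma>' r" if r: "r \<in> {1..n}" for r
    proof -
      have "(\<sigma> r, r) \<in> F" using * r by (auto simp: placements_def row_def)
      then show ?thesis
        using filling_of_eq_1[of "\<sigma> r" r \<sigma>] filling_of_eq_1[of "\<sigma> r" r \<sigma>'] * by auto
    qed
    with * show "\<sigma> = \<sigma>'"
      by (intro extensionalityI[of _ "{1..n}"]) (auto simp: placements_def)
  qed
next
  show "filling_of ` placements = fillings F"
  proof (intro equalityI subsetI)
    fix f assume "f \<in> filling_of ` placements"
    then obtain \<sigma> where \<sigma>: "\<sigma> \<in> placements" "f = filling_of \<sigma>" by auto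
    have F: "(\<sigma> j, j) \<in> F" if "j \<in> {1..n}" for j
      using \<sigma> that by (auto simp: placements_def row_def)
    have bij: "bij_betw \<sigma> {1..n} {1..n}" using \<sigma> by (auto simp: placements_def)
    have "\<exists>!i. (i, j) \<in> F \<and> f (i, j) = 1" if "j \<in> {1..n}" for j
      unfolding \<sigma>(2) using F[OF that] filling_of_eq_1[of _ j \<sigma>]
      by (intro ex1I[of _ "\<sigma> j"]) auto
    moreover have "\<exists>!j. (i, j) \<in> F \<and> f (i, j) = 1" if "i \<in> {1..n}" for i
    proof -
      have "i \<in> \<sigma> ` {1..n}" using bij_betw_imp_surj_on[OF bij] that by simp
      then obtain j where j: "j \<in> {1..n}" "\<sigma> j = i" by blast
      show ?thesis
      proof (rule ex1I[of _ j])
        show "(i, j) \<in> F \<and> f (i, j) = 1" using F[OF j(1)] filling_of_eq_1[of i j \<sigma>] j \<sigma>(2) by simp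
        fix j' assume "(i, j') \<in> F \<and> f (i, j') = 1"
        then have "\<sigma> j' = \<sigma> j" "j' \<in> {1..n}"
          using filling_of_eq_1[of i j' \<sigma>] \<sigma>(2) j board_range[of i j'] by simp_all
        then show "j' = j" using inj_onD[OF bij_betw_imp_inj_on[OF bij]] j(1) by blast
      qed
    qed
    moreover have "f \<in> F \<rightarrow>\<^sub>E {0, 1}"
      unfolding \<sigma>(2) filling_of_def by (auto split: if_splits)
    ultimately show "f \<in> fillings F"
      unfolding fillings_def cols rows by blast
  next
    fix f assume f: "f \<in> fillings F"
    define \<sigma> where "\<sigma> = restrict (\<lambda>j. THE i. (i, j) \<in> F \<and> f (i, j) = 1) {1..n}"
    have ex1: "\<exists>!i. (i, j) \<in> F \<and> f (i, j) = 1" if "j \<in> {1..n}" for j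
      using f that by (simp add: fillings_def rows)
    have ex1': "\<exists>!j. (i, j) \<in> F \<and> f (i, j) = 1" if "i \<in> {1..n}" for i
      using f that by (simp add: fillings_def cols)
    have \<sigma>: "(\<sigma> j, j) \<in> F \<and> f (\<sigma> j, j) = 1" if "j \<in> {1..n}" for j
      using theI'[OF ex1[OF that]] that by (simp add: \<sigma>_def)
    have inj: "inj_on \<sigma> {1..n}"
    proof (rule inj_onI)
      fix j j' assume *: "j \<in> {1..n}" "j' \<in> {1..n}" "\<sigma> j = \<sigma> j'"
      show "j = j'" using \<sigma>[OF *(1)] \<sigma>[OF *(2)] *(3) ex1'[of "\<sigma> j"] board_range[of "\<sigma> j" j] by metis
    qed
    have "\<sigma> ` {1..n} \<subseteq> {1..n}" using \<sigma> board_range by blast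
    \<comment> \<open>An injective map of a finite set into itself is onto.\<close>
    then have "bij_betw \<sigma> {1..n} {1..n}"
      using inj by (intro bij_betw_imageI endo_inj_surj) auto
    then have "\<sigma> \<in> placements"
      using \<sigma> by (simp add: placements_def row_def \<sigma>_def)
    moreover have "f = filling_of \<sigma>"
    proof (rule extensionalityI[of _ F])
      show "f \<in> extensional F" using f by (auto simp: fillings_def PiE_def)
      show "filling_of \<sigma> \<in> extensional F" by (simp add: filling_of_def)
      fix p assume p: "p \<in> F"
      obtain i j where ij: "p = (i, j)" by (cases p)
      have "f p \<in> {0, 1}" using f p by (auto simp: fillings_def)
      moreover have "f p = 1 \<longleftrightarrow> \<sigma> j = i"
        using \<sigma>[of j] ex1[of j] board_range[of i j] p ij by blast
      ultimately show "f p = filling_of \<sigma> p"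
        using p ij by (auto simp: filling_of_def)
    qed
    ultimately show "f \<in> filling_of ` placements" by blast
  qed
qed

section \<open>Occurrences of the first pattern and free columns\<close>

text \<open>The largest entry of an occurrence sits at position \<open>a\<close>, in its top row
  \<open>r\<close>. The other columns of the occurrence meet row \<open>r\<close> and have their
  ones below it, so they are free. Conversely, \<open>a - 1\<close> free columns on the left and
  \<open>k - a\<close> on the right of \<open>\<sigma> r\<close> form an occurrence with it: their
  ones lie below row \<open>r\<close>, and all cells needed are on the board because it is closed
  downwards.\<close>

lemma contains_pop1_iff:
  assumes \<sigma>: "\<sigma> \<in> placements" and a: "a \<in> {1..k}"
  shows "(\<exists>q\<in>pop_patterns k (pop1 k a). filling_contains F (filling_of \<sigma>) q) \<longleftrightarrow>
    (\<exists>r\<in>{1..n}. a - 1 \<le> card {x \<in> free \<sigma> r. x < \<sigma> r} \<and> k - a \<le> card {x \<in> free \<sigma> r. \<sigma> r < x})"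
proof
  have bij: "bij_betw \<sigma> {1..n} {1..n}" using \<sigma> by (auto simp: placements_def)
  have inj: "\<sigma> r = \<sigma> s \<Longrightarrow> r \<in> {1..n} \<Longrightarrow> s \<in> {1..n} \<Longrightarrow> r = s" for r s
    using bij by (auto simp: bij_betw_def dest: inj_onD)
  assume "\<exists>q\<in>pop_patterns k (pop1 k a). filling_contains F (filling_of \<sigma>) q"
  then obtain q where q: "q permutes {1..k}" "\<And>j. j \<in> {1..k} \<Longrightarrow> j \<noteq> a \<Longrightarrow> q j < q a"
    and con: "filling_contains F (filling_of \<sigma>) (k, q)"
    by (auto simp: pop_patterns_def pop1_def)
  from con obtain c \<rho> where mono: "strict_mono_on {1..k} c" "strict_mono_on {1..k} \<rho>"
    and occ: "\<And>i j. i \<in> {1..k} \<Longrightarrow> j \<in> {1..k} \<Longrightarrow>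
      (c i, \<rho> j) \<in> F \<and> (filling_of \<sigma> (c i, \<rho> j) = 1 \<longleftrightarrow> q i = j)"
    unfolding filling_contains_def by auto
  have qk: "q j \<in> {1..k}" if "j \<in> {1..k}" for j using that permutes_in_image[OF q(1)] by blast
  \<comment> \<open>As \<open>q a\<close> is the largest value, this is the top row of the
    occurrence.\<close>
  define r where "r = \<rho> (q a)"
  have \<sigma>\<rho>: "\<sigma> (\<rho> (q j)) = c j" if "j \<in> {1..k}" for j
    using occ[OF that qk[OF that]] filling_of_eq_1[of "c j" "\<rho> (q j)" \<sigma>] by simp
  have r: "r \<in> {1..n}" "\<sigma> r = c a"
    using occ[OF a qk[OF a]] board_range[of "c a" r] \<sigma>\<rho>[OF a] by (simp_all add: r_def)
  have free: "c j \<in> free \<sigma> r" if j: "j \<in> {1..k}" "j \<noteq> a" for j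
  proof -
    have "(c j, r) \<in> F" using occ[OF j(1) qk[OF a]] by (simp add: r_def)
    moreover have "\<rho> (q j) < r"
      using mono(2) qk[OF a] qk[OF j(1)] q(2)[OF j] by (auto simp: r_def strict_mono_on_def)
    moreover have "\<rho> (q j) \<in> {1..n}"
      using occ[OF j(1) qk[OF j(1)]] board_range[of "c j" "\<rho> (q j)"] by simp
    ultimately show ?thesis
      using \<sigma>\<rho>[OF j(1)] inj[of "\<rho> (q j)"] r(1) unfolding free_def row_def by force
  qed
  have injc: "inj_on c {1..k}" using mono(1) by (rule strict_mono_on_imp_inj_on)
  have fin: "finite (free \<sigma> r)" using finite_row by (simp add: free_def)
  have mc: "i < j \<Longrightarrow> i \<in> {1..k} \<Longrightarrow> j \<in> {1..k} \<Longrightarrow> c i < c j" for i j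
    using mono(1) by (auto simp: strict_mono_on_def)
  have "card (c ` {1..<a}) \<le> card {x \<in> free \<sigma> r. x < \<sigma> r}"
    using fin a r(2) by (intro card_mono) (auto intro!: free mc)
  moreover have "card (c ` {a<..k}) \<le> card {x \<in> free \<sigma> r. \<sigma> r < x}"
    using fin a r(2) by (intro card_mono) (auto intro!: free mc)
  moreover have "card (c ` {1..<a}) = a - 1" "card (c ` {a<..k}) = k - a"
    using a by (subst card_image, auto intro!: inj_on_subset[OF injc])+
  ultimately show "\<exists>r\<in>{1..n}. a - 1 \<le> card {x \<in> free \<sigma> r. x < \<sigma> r} \<and>
      k - a \<le> card {x \<in> free \<sigma> r. \<sigma> r < x}"
    using r(1) by auto
next
  have bij: "bij_betw \<sigma> {1..n} {1..n}" using \<sigma> by (auto simp: placements_def)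
  assume "\<exists>r\<in>{1..n}. a - 1 \<le> card {x \<in> free \<sigma> r. x < \<sigma> r} \<and>
      k - a \<le> card {x \<in> free \<sigma> r. \<sigma> r < x}"
  then obtain r X Y where r: "r \<in> {1..n}"
    and X: "X \<subseteq> {x \<in> free \<sigma> r. x < \<sigma> r}" "card X = a - 1" "finite X"
    and Y: "Y \<subseteq> {x \<in> free \<sigma> r. \<sigma> r < x}" "card Y = k - a" "finite Y"
    by (meson obtain_subset_with_card_n)
  \<comment> \<open>These are the \<open>(a - 1) + 1 + (k - a) = k\<close> columns of the occurrence
    to be built.\<close>
  define Z where "Z = X \<union> insert (\<sigma> r) Y"
  have "card Z = card X + card (insert (\<sigma> r) Y)"
    unfolding Z_def using X Y by (intro card_Un_disjoint) fastforce+
  moreover have "card (insert (\<sigma> r) Y) = Suc (card Y)" using Y by (subst card_insert_disjoint) auto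
  ultimately have Z: "finite Z" "card Z = k" using X Y a by (auto simp: Z_def)
  have "\<sigma> r \<in> row r" "\<sigma> r \<notin> \<sigma> ` {r<..n}"
    using \<sigma> r bij by (auto simp: placements_def bij_betw_def dest!: inj_onD)
  then have Zfree: "Z \<subseteq> free \<sigma> r" using X Y by (auto simp: Z_def free_def)
  \<comment> \<open>\<open>\<tau> x\<close> is the row of the one in column \<open>x\<close>. For
    free columns it is at most \<open>r\<close>.\<close>
  define \<tau> where "\<tau> = inv_into {1..n} \<sigma>"
  have \<tau>: "\<tau> x \<in> {1..r} \<and> \<sigma> (\<tau> x) = x" if "x \<in> Z" for x
  proof -
    have x: "x \<in> {1..n}" "x \<notin> \<sigma> ` {r<..n}"
      using that Zfree row_subset[of r] unfolding free_def by blast+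
    have "\<tau> x \<in> {1..n}"
      unfolding \<tau>_def using bij_betwE[OF bij_betw_inv_into[OF bij]] x(1) by blast
    moreover have "\<sigma> (\<tau> x) = x"
      unfolding \<tau>_def using bij x(1) by (rule bij_betw_inv_into_right)
    ultimately show ?thesis
      using x(2) by (metis atLeastAtMost_iff greaterThanAtMost_iff imageI not_le)
  qed
  have \<tau>r: "\<tau> (\<sigma> r) = r" using bij r by (auto simp: \<tau>_def bij_betw_def)
  have inj\<tau>: "inj_on \<tau> Z" using \<tau> by (metis inj_onI)
  obtain c where c: "strict_mono_on {1..k} c" "bij_betw c {1..k} Z"
    using ex_increasing_enumeration[OF Z] .
  obtain \<rho> where \<rho>: "strict_mono_on {1..k} \<rho>" "bij_betw \<rho> {1..k} (\<tau> ` Z)"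
    using ex_increasing_enumeration[of "\<tau> ` Z" k] Z inj\<tau> by (auto simp: card_image)
  have cZ: "c i \<in> Z" if "i \<in> {1..k}" for i using c(2) that by (auto simp: bij_betw_def)
  have \<rho>Z: "\<rho> i \<in> \<tau> ` Z" if "i \<in> {1..k}" for i using \<rho>(2) that by (auto simp: bij_betw_def)
  \<comment> \<open>Exactly the \<open>a - 1\<close> elements of \<open>X\<close> precede
    \<open>\<sigma> r\<close> in the increasing enumeration of \<open>Z\<close>.\<close>
  have ca: "c a = \<sigma> r"
  proof -
    have "\<sigma> r \<in> c ` {1..k}" using bij_betw_imp_surj_on[OF c(2)] by (simp add: Z_def)
    then obtain j where "\<sigma> r = c j" "j \<in> {1..k}" by (rule imageE)
    then have j: "j \<in> {1..k}" "c j = \<sigma> r" by simp_all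
    have lt: "c i < c j \<longleftrightarrow> i < j" if "i \<in> {1..k}" for i
      using strict_mono_on_less[OF c(1) that j(1)] .
    have "X = {z \<in> Z. z < \<sigma> r}" using X Y by (auto simp: Z_def)
    also have "\<dots> = c ` {1..<j}"
      using c(2) lt j by (auto simp: bij_betw_def)
    finally have "card X = card (c ` {1..<j})" by simp
    also have "\<dots> = j - 1"
      using j(1) by (subst card_image) (auto intro: inj_on_subset[OF bij_betw_imp_inj_on[OF c(2)]])
    finally have "j = a" using X(2) a j(1) by auto
    then show ?thesis using j(2) by simp
  qed
  \<comment> \<open>The pattern is read off by standardization: \<open>q i\<close> is the rank of
    the row of the one in column \<open>c i\<close>. Outside \<open>{1..k}\<close> it is the
    identity, as \<open>permutes\<close> demands.\<close>
  define q where "q i = (if i \<in> {1..k} then inv_into {1..k} \<rho> (\<tau> (c i)) else i)" for i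
  have "bij_betw (inv_into {1..k} \<rho> \<circ> (\<tau> \<circ> c)) {1..k} {1..k}"
    using c(2) inj\<tau> bij_betw_inv_into[OF \<rho>(2)]
    by (intro bij_betw_trans) (auto simp: bij_betw_def)
  then have "bij_betw q {1..k} {1..k}"
    by (rule bij_betw_cong[THEN iffD1, rotated]) (simp add: q_def)
  then have perm: "q permutes {1..k}" by (rule bij_imp_permutes) (auto simp: q_def)
  then have qk: "q i \<in> {1..k}" if "i \<in> {1..k}" for i using that permutes_in_image[OF perm] by blast
  have \<rho>q: "\<rho> (q i) = \<tau> (c i)" if "i \<in> {1..k}" for i
    using that cZ[OF that] \<rho>(2) by (simp add: q_def bij_betw_def f_inv_into_f)
  have "q j < q a" if j: "j \<in> {1..k}" "j \<noteq> a" for j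
  proof -
    \<comment> \<open>The right-hand side is row \<open>r\<close>, above which no column of
      \<open>Z\<close> has its one.\<close>
    have "\<rho> (q j) \<le> \<rho> (q a)"
      using \<rho>q[OF j(1)] \<rho>q[OF a] ca \<tau>r \<tau>[OF cZ[OF j(1)]] by simp
    then have "q j \<le> q a" using strict_mono_on_less_eq[OF \<rho>(1) qk[OF j(1)] qk[OF a]] by simp
    moreover have "q j \<noteq> q a" using perm j(2) by (metis permutes_inj injD)
    ultimately show ?thesis by simp
  qed
  then have "(k, q) \<in> pop_patterns k (pop1 k a)"
    using perm by (auto simp: pop_patterns_def pop1_def)
  moreover have "(c i, \<rho> j) \<in> F \<and> (filling_of \<sigma> (c i, \<rho> j) = 1 \<longleftrightarrow> q i = j)"
    if i: "i \<in> {1..k}" and j: "j \<in> {1..k}" for i j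
  proof -
    obtain z where z: "z \<in> Z" "\<rho> j = \<tau> z" using \<rho>Z[OF j] by auto
    have \<rho>j: "\<rho> j \<in> {1..r}" using \<tau>[OF z(1)] z(2) by simp
    have "(c i, r) \<in> F" using cZ[OF i] Zfree by (auto simp: free_def row_def)
    then have F: "(c i, \<rho> j) \<in> F"
      using \<rho>j board_down[of "c i" r "c i" "\<rho> j"] board_range[of "c i" r] by simp
    have "\<sigma> (\<rho> j) = c i \<longleftrightarrow> \<rho> j = \<rho> (q i)"
      using \<tau>[OF z(1)] z \<tau>[OF cZ[OF i]] \<rho>q[OF i] by metis
    also have "\<dots> \<longleftrightarrow> q i = j"
      using \<rho>(2) qk[OF i] j by (auto simp: bij_betw_def dest: inj_onD)
    finally show ?thesis using F filling_of_eq_1[OF F] by simp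
  qed
  then have "filling_contains F (filling_of \<sigma>) (k, q)"
    unfolding filling_contains_def using c(1) \<rho>(1)
    by (intro case_prodI exI[of _ c] exI[of _ \<rho>]) auto
  ultimately show "\<exists>q\<in>pop_patterns k (pop1 k a). filling_contains F (filling_of \<sigma>) q"
    by blast
qed

section \<open>The product formula for the first pattern\<close>

text \<open>By \<open>contains_pop1_iff\<close>, avoidance is a separate condition on the choice in
  each row, given the columns used above it. So \<open>card_sequential_choice\<close> applies, with
  the factors supplied by \<open>card_extreme_positions\<close>.\<close>

lemma card_avoiding_pop1:
  assumes a: "a \<in> {1..k}"
  shows "card (avoiding_fillings F (pop_patterns k (pop1 k a))) =
    (\<Prod>r=1..n. min (card (row r) + r - n) (k - 1))"
proof -
  \<comment> \<open>Here \<open>U\<close> stands for the columns used above row \<open>r\<close>,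
    and the options are the free columns that do not make \<open>r\<close> the top row of an
    occurrence.\<close>
  define A where "A r U = {c \<in> row r - U.
    \<not> (a - 1 \<le> card {x \<in> row r - U. x < c} \<and> k - a \<le> card {x \<in> row r - U. c < x})}" for r U
  define W where "W = {\<sigma> \<in> extensional {1..n}. \<forall>r\<in>{1..n}. \<sigma> r \<in> A r (\<sigma> ` {r<..n})}"
  have "W = {\<sigma> \<in> placements. \<not> (\<exists>q\<in>pop_patterns k (pop1 k a). filling_contains F (filling_of \<sigma>) q)}"
  proof (intro equalityI subsetI)
    fix \<sigma> assume \<sigma>: "\<sigma> \<in> W"
    \<comment> \<open>For \<open>r < s\<close> the column \<open>\<sigma> s\<close> is among those
      excluded when row \<open>r\<close> is filled.\<close>
    have inj: "inj_on \<sigma> {1..n}"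
      by (rule linorder_inj_onI) (use \<sigma> in \<open>force simp: W_def A_def\<close>)+
    have row: "\<sigma> r \<in> row r" if "r \<in> {1..n}" for r
      using \<sigma> that by (simp add: W_def A_def)
    then have "\<sigma> ` {1..n} \<subseteq> {1..n}" using row_subset by blast
    then have "bij_betw \<sigma> {1..n} {1..n}"
      using inj by (intro bij_betw_imageI endo_inj_surj) auto
    then have "\<sigma> \<in> placements"
      using \<sigma> row by (simp add: placements_def W_def)
    with \<sigma> show "\<sigma> \<in> {\<sigma> \<in> placements. \<not> (\<exists>q\<in>pop_patterns k (pop1 k a). filling_contains F (filling_of \<sigma>) q)}"
      using contains_pop1_iff[OF _ a] by (auto simp: W_def A_def free_def)
  next
    fix \<sigma> assume \<sigma>: "\<sigma> \<in> {\<sigma> \<in> placements. \<not> (\<exists>q\<in>pop_patterns k (pop1 k a). filling_contains F (filling_of \<sigma>) q)}"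
    have "\<sigma> r \<in> row r - \<sigma> ` {r<..n}" if "r \<in> {1..n}" for r
      using \<sigma> that by (auto simp: placements_def bij_betw_def dest!: inj_onD)
    with \<sigma> show "\<sigma> \<in> W"
      using contains_pop1_iff[OF _ a, of \<sigma>] by (auto simp: W_def A_def free_def placements_def)
  qed
  note W = this
  have "avoiding_fillings F (pop_patterns k (pop1 k a)) = filling_of ` W"
    unfolding W using bij_betw_filling_of by (auto simp: avoiding_fillings_def bij_betw_def)
  moreover have "inj_on filling_of W"
    using bij_betw_filling_of W by (auto simp: bij_betw_def intro: inj_on_subset)
  ultimately have "card (avoiding_fillings F (pop_patterns k (pop1 k a))) = card W"
    by (simp add: card_image)
  also have "\<dots> = (\<Prod>r=1..n. min (card (row r) + r - n) (k - 1))"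
    unfolding W_def
  proof (rule card_sequential_choice)
    show "finite (A r U)" for r U using finite_row by (simp add: A_def)
    fix r and \<sigma> :: "nat \<Rightarrow> nat"
    assume r: "r \<in> {1..n}" and \<sigma>: "\<forall>s\<in>{r<..n}. \<sigma> s \<in> A s (\<sigma> ` {s<..n})"
    have "inj_on \<sigma> {r<..n}"
      by (rule linorder_inj_onI) (use \<sigma> in \<open>force simp: A_def\<close>)+
    then have "card (\<sigma> ` {r<..n}) = n - r" by (simp add: card_image)
    \<comment> \<open>Higher rows are no longer, so each of the \<open>n - r\<close> columns used
      above costs row \<open>r\<close> one cell.\<close>
    moreover have "\<sigma> ` {r<..n} \<subseteq> row r"
    proof (rule image_subsetI)
      fix s assume s: "s \<in> {r<..n}"
      then have "\<sigma> s \<in> row s" using \<sigma> unfolding A_def by blast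
      then show "\<sigma> s \<in> row r" using row_antimono[of r s] r s by auto
    qed
    ultimately have "card (row r - \<sigma> ` {r<..n}) = card (row r) - (n - r)"
      by (simp add: card_Diff_subset)
    also have "\<dots> = card (row r) + r - n" using r by auto
    finally show "card (A r (\<sigma> ` {r<..n})) = min (card (row r) + r - n) (k - 1)"
      unfolding A_def using a card_extreme_positions[of "row r - \<sigma> ` {r<..n}" a k] finite_row
      by simp
  qed
  finally show ?thesis .
qed

section \<open>Row lengths of a board and of its transpose\<close>

lemma row_eq: "row r = {1..card (row r)}" if "r \<in> {1..n}"
proof (rule downward_closed_eq_atLeastAtMost)
  show "0 \<notin> row r" using row_subset[of r] by auto
  show "i \<in> row r" if "j \<in> row r" "1 \<le> i" "i \<le> j" for i j
    using that \<open>r \<in> {1..n}\<close> board_down[of j r i r] by (simp add: row_def)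
qed (rule finite_row)

text \<open>Telescoping along the rows. The right-hand side does not change when \<open>F\<close> is transposed.\<close>

lemma sum_row_ends:
  fixes g :: "nat \<Rightarrow> int"
  shows "(\<Sum>r=1..n. g (card (row r) + r)) =
    (\<Sum>r=1..n. g r) + (\<Sum>(i, j)\<in>F. g (i + j) - g (i + j - 1))"
proof -
  have tele: "(\<Sum>i=1..m. g (i + r) - g (i + r - 1)) = g (m + r) - g r" for m r
    by (induction m) auto
  have "(\<Sum>(i, j)\<in>F. g (i + j) - g (i + j - 1)) = (\<Sum>(r, i)\<in>F\<inverse>. g (i + r) - g (i + r - 1))"
    by (rule sum.reindex_bij_witness[where i = prod.swap and j = prod.swap]) auto
  also have "F\<inverse> = (SIGMA r:{1..n}. row r)"
    using board_range unfolding row_def by blast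
  also have "(\<Sum>(r, i)\<in>(SIGMA r:{1..n}. row r). g (i + r) - g (i + r - 1)) =
      (\<Sum>r=1..n. \<Sum>i\<in>row r. g (i + r) - g (i + r - 1))"
    using finite_row by (simp add: sum.Sigma)
  also have "\<dots> = (\<Sum>r=1..n. g (card (row r) + r) - g r)"
  proof (rule sum.cong)
    fix r assume "r \<in> {1..n}"
    have "(\<Sum>i\<in>row r. g (i + r) - g (i + r - 1)) =
        (\<Sum>i=1..card (row r). g (i + r) - g (i + r - 1))"
      by (rule sum.cong[OF row_eq[OF \<open>r \<in> {1..n}\<close>]]) (rule refl)
    also have "\<dots> = g (card (row r) + r) - g r" by (rule tele)
    finally show "(\<Sum>i\<in>row r. g (i + r) - g (i + r - 1)) = g (card (row r) + r) - g r" .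
  qed simp
  finally show ?thesis by (simp add: sum_subtractf)
qed

end

lemma ferrers_board_converse: "ferrers_board F \<Longrightarrow> ferrers_board (F\<inverse>)"
  unfolding ferrers_board_def by fastforce

lemma fst_image_converse: "fst ` (F\<inverse>) = snd ` F"
  and snd_image_converse: "snd ` (F\<inverse>) = fst ` F"
  by force+

lemma square_board_converse: "square_board F n \<Longrightarrow> square_board (F\<inverse>) n"
  by (simp add: square_board_def ferrers_board_converse fst_image_converse snd_image_converse)

text \<open>Taking indicator functions for \<open>g\<close> shows that \<open>u\<close> and
  \<open>v\<close> attain each value equally often. Integer sums suit the telescoping differences,
  while \<open>w\<close> is left arbitrary.\<close>

lemma prod_eq_if_all_sums_eq:
  fixes u :: "'a \<Rightarrow> 'c" and v :: "'b \<Rightarrow> 'c" and w :: "'c \<Rightarrow> 'd::comm_monoid_mult"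
  assumes fin: "finite A" "finite B"
    and eq: "\<And>g :: 'c \<Rightarrow> int. (\<Sum>x\<in>A. g (u x)) = (\<Sum>y\<in>B. g (v y))"
  shows "(\<Prod>x\<in>A. w (u x)) = (\<Prod>y\<in>B. w (v y))"
proof -
  have "card {x \<in> A. u x = t} = card {y \<in> B. v y = t}" for t
    using eq[of "\<lambda>s. if s = t then 1 else 0"] fin
    by (simp add: sum.If_cases Int_def)
  moreover have "(\<Prod>x\<in>A. w (u x)) = (\<Prod>t\<in>u ` A \<union> v ` B. w t ^ card {x \<in> A. u x = t})"
    using fin by (subst prod.group[symmetric, where g = u and T = "u ` A \<union> v ` B"]) auto
  moreover have "(\<Prod>y\<in>B. w (v y)) = (\<Prod>t\<in>u ` A \<union> v ` B. w t ^ card {y \<in> B. v y = t})"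
    using fin by (subst prod.group[symmetric, where g = v and T = "u ` A \<union> v ` B"]) auto
  ultimately show ?thesis by simp
qed

text \<open>In \<open>sum_row_ends\<close> the summand of a cell depends only on
  \<open>i + j\<close>, which transposition preserves. This holds for all \<open>g\<close>, so both
  boards have the same multiset of values \<open>card (row r) + r\<close>.\<close>

lemma prod_row_ends_converse:
  fixes w :: "nat \<Rightarrow> nat"
  assumes "square_board F n"
  shows "(\<Prod>r=1..n. w (card (square_board.row F r) + r)) =
    (\<Prod>r=1..n. w (card (square_board.row (F\<inverse>) r) + r))"
proof (rule prod_eq_if_all_sums_eq)
  fix g :: "nat \<Rightarrow> int"
  have "(\<Sum>(i, j)\<in>F. g (i + j) - g (i + j - 1)) = (\<Sum>(i, j)\<in>F\<inverse>. g (i + j) - g (i + j - 1))"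
    by (rule sum.reindex_bij_witness[where i = prod.swap and j = prod.swap]) (auto simp: add.commute)
  then show "(\<Sum>r=1..n. g (card (square_board.row F r) + r)) =
      (\<Sum>r=1..n. g (card (square_board.row (F\<inverse>) r) + r))"
    using square_board.sum_row_ends[OF assms, of g]
      square_board.sum_row_ends[OF square_board_converse[OF assms], of g] by simp
qed simp_all

section \<open>Transposing fillings and patterns\<close>

lemma fillings_converse:
  assumes "f \<in> fillings F"
  shows "f \<circ> prod.swap \<in> fillings (F\<inverse>)"
proof -
  have f: "f \<in> F \<rightarrow>\<^sub>E {0, 1}" using assms by (simp add: fillings_def)
  have "f \<circ> prod.swap \<in> F\<inverse> \<rightarrow>\<^sub>E {0, 1}"
  proof (rule PiE_I)
    fix p assume "p \<in> F\<inverse>"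
    then show "(f \<circ> prod.swap) p \<in> {0, 1}" using PiE_mem[OF f, of "prod.swap p"] by (cases p) simp
  next
    fix p assume "p \<notin> F\<inverse>"
    then show "(f \<circ> prod.swap) p = undefined" using PiE_arb[OF f, of "prod.swap p"] by (cases p) simp
  qed
  then show ?thesis
    using assms unfolding fillings_def fst_image_converse snd_image_converse by simp
qed

text \<open>Transposition exchanges the column and row sequences of an occurrence, hence positions
  and values of the pattern.\<close>

lemma filling_contains_converse:
  assumes "q permutes {1..k}" "filling_contains (F\<inverse>) (f \<circ> prod.swap) (k, inv q)"
  shows "filling_contains F f (k, q)"
proof -
  obtain c r where "strict_mono_on {1..k} c" "strict_mono_on {1..k} r"
    and "\<And>a b. a \<in> {1..k} \<Longrightarrow> b \<in> {1..k} \<Longrightarrow>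
      (r b, c a) \<in> F \<and> (f (r b, c a) = 1 \<longleftrightarrow> inv q a = b)"
    using assms(2) unfolding filling_contains_def by auto
  moreover have "inv q a = b \<longleftrightarrow> q b = a" for a b
    using permutes_inv_eq[OF assms(1)] by blast
  ultimately show ?thesis unfolding filling_contains_def
    by (intro case_prodI exI[of _ r] exI[of _ c]) auto
qed

lemma avoiding_fillings_converse:
  assumes "\<And>k q. (k, q) \<in> Q \<Longrightarrow> q permutes {1..k}" and "f \<in> avoiding_fillings F Q"
  shows "f \<circ> prod.swap \<in> avoiding_fillings (F\<inverse>) ((\<lambda>(k, q). (k, inv q)) ` Q)"
  using assms fillings_converse filling_contains_converse
  unfolding avoiding_fillings_def by fast

text \<open>Transposing twice restores board and filling, and inverting twice restores each pattern.
  Thus \<open>avoiding_fillings_converse\<close>, used for both boards, yields two mutually inverse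
  maps.\<close>

lemma card_avoiding_fillings_converse:
  assumes Q: "\<And>k q. (k, q) \<in> Q \<Longrightarrow> q permutes {1..k}"
  shows "card (avoiding_fillings (F\<inverse>) ((\<lambda>(k, q). (k, inv q)) ` Q)) = card (avoiding_fillings F Q)"
proof -
  let ?Q' = "(\<lambda>(k, q). (k, inv q)) ` Q"
  have Q': "q permutes {1..k}" if "(k, q) \<in> ?Q'" for k q
    using that by (auto dest!: Q intro: permutes_inv)
  have "(\<lambda>(k, q). (k, inv q)) ` ?Q' = (\<lambda>p. p) ` Q"
    unfolding image_image by (intro image_cong) (auto dest!: Q simp: permutes_inv_inv)
  then have "(\<lambda>f. f \<circ> prod.swap) ` avoiding_fillings (F\<inverse>) ?Q' \<subseteq> avoiding_fillings F Q"
    using avoiding_fillings_converse[of ?Q' _ "F\<inverse>", OF Q'] by auto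
  moreover have "(\<lambda>f. f \<circ> prod.swap) ` avoiding_fillings F Q \<subseteq> avoiding_fillings (F\<inverse>) ?Q'"
    using avoiding_fillings_converse[OF Q] by blast
  ultimately have "bij_betw (\<lambda>f. f \<circ> prod.swap) (avoiding_fillings (F\<inverse>) ?Q') (avoiding_fillings F Q)"
    by (intro bij_betw_byWitness[where f' = "\<lambda>f. f \<circ> prod.swap"]) (auto simp: comp_assoc)
  then show ?thesis by (rule bij_betw_same_card)
qed

section \<open>The classical patterns behind the two posets\<close>

text \<open>A permutation has its maximum at 1 precisely when the value there is \<open>k\<close>.
  In this form, as in \<open>pop2_patterns_eq\<close>, the condition fixes a single value and is
  easy to invert.\<close>

lemma pop1_patterns_eq:
  assumes "1 \<le> k"
  shows "pop_patterns k (pop1 k 1) = {(k, q) | q. q permutes {1..k} \<and> q 1 = k}"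
proof -
  have "(\<forall>(j, m)\<in>pop1 k 1. q j < q m) \<longleftrightarrow> q 1 = k" if q: "q permutes {1..k}" for q
  proof -
    have *: "(\<forall>(j, m)\<in>pop1 k 1. q j < q m) \<longleftrightarrow> (\<forall>j\<in>{1..k}. j \<noteq> 1 \<longrightarrow> q j < q 1)"
      by (auto simp: pop1_def)
    have mem: "j \<in> {1..k} \<Longrightarrow> q j \<in> {1..k}" for j using permutes_in_image[OF q] by blast
    have "k \<in> q ` {1..k}" using permutes_image[OF q] assms by simp
    then obtain m where m: "k = q m" "m \<in> {1..k}" by (rule imageE)
    have "m = 1" if "\<forall>j\<in>{1..k}. j \<noteq> 1 \<longrightarrow> q j < q 1"
    proof (rule ccontr)
      assume "m \<noteq> 1"
      then have "k < q 1" using that m by metis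
      then show False using mem[of 1] assms by simp
    qed
    moreover have "q j < q 1" if "q 1 = k" "j \<in> {1..k}" "j \<noteq> 1" for j
      using mem[of j] injD[OF permutes_inj[OF q], of j 1] that by fastforce
    ultimately show ?thesis using * m by metis
  qed
  then show ?thesis unfolding pop_patterns_def by blast
qed

lemma pop2_patterns_eq:
  assumes "1 \<le> k"
  shows "pop_patterns k (pop2 k) = {(k, q) | q. q permutes {1..k} \<and> q k = 1}"
proof -
  have "(\<forall>(j, m)\<in>pop2 k. q j < q m) \<longleftrightarrow> q k = 1" if q: "q permutes {1..k}" for q
  proof -
    have "j \<in> {1..k - 1} \<longleftrightarrow> j \<in> {1..k} \<and> j \<noteq> k" for j using assms by auto
    then have *: "(\<forall>(j, m)\<in>pop2 k. q j < q m) \<longleftrightarrow> (\<forall>j\<in>{1..k}. j \<noteq> k \<longrightarrow> q k < q j)"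
      unfolding pop2_def by blast
    have mem: "j \<in> {1..k} \<Longrightarrow> q j \<in> {1..k}" for j using permutes_in_image[OF q] by blast
    have "1 \<in> q ` {1..k}" using permutes_image[OF q] assms by simp
    then obtain m where m: "1 = q m" "m \<in> {1..k}" by (rule imageE)
    have "m = k" if "\<forall>j\<in>{1..k}. j \<noteq> k \<longrightarrow> q k < q j"
    proof (rule ccontr)
      assume "m \<noteq> k"
      then have "q k < 1" using that m by metis
      then show False using mem[of k] assms by simp
    qed
    moreover have "q k < q j" if "q k = 1" "j \<in> {1..k}" "j \<noteq> k" for j
      using mem[of j] injD[OF permutes_inj[OF q], of j k] that by fastforce
    ultimately show ?thesis using * m by metis
  qed
  then show ?thesis unfolding pop_patterns_def by blast
qed

text \<open>Inversion turns the condition \<open>q k = 1\<close> into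
  \<open>inv q 1 = k\<close>.\<close>

lemma inv_image_pop2_patterns:
  assumes "1 \<le> k"
  shows "(\<lambda>(k, q). (k, inv q)) ` pop_patterns k (pop2 k) = pop_patterns k (pop1 k 1)"
proof -
  have "(k, q) \<in> (\<lambda>(k, q). (k, inv q)) ` {(k, q) | q. q permutes {1..k} \<and> q k = 1}"
    if "q permutes {1..k}" "q 1 = k" for q
    using permutes_inv[OF that(1)] permutes_inv_inv[OF that(1)] permutes_inv_eq[OF that(1)] that(2)
    by (intro image_eqI[of _ _ "(k, inv q)"]) simp_all
  moreover have "inv q permutes {1..k} \<and> inv q 1 = k" if "q permutes {1..k}" "q k = 1" for q
    using that permutes_inv permutes_inv_eq[OF that(1)] by blast
  ultimately show ?thesis
    unfolding pop1_patterns_eq[OF assms] pop2_patterns_eq[OF assms] by auto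
qed

section \<open>Boards that admit a filling\<close>

text \<open>The cells holding a one project bijectively onto the nonempty columns and onto the
  nonempty rows.\<close>

lemma card_rows_eq_card_cols:
  assumes "f \<in> fillings F"
  shows "card (fst ` F) = card (snd ` F)"
proof -
  define O1 where "O1 = {p \<in> F. f p = 1}"
  have cols: "\<forall>i\<in>fst ` F. \<exists>!j. (i, j) \<in> F \<and> f (i, j) = 1"
    using assms unfolding fillings_def mem_Collect_eq by (elim conjE)
  have rows: "\<forall>j\<in>snd ` F. \<exists>!i. (i, j) \<in> F \<and> f (i, j) = 1"
    using assms unfolding fillings_def mem_Collect_eq by (elim conjE)
  have "bij_betw fst O1 (fst ` F)"
  proof (rule bij_betw_imageI)
    show "inj_on fst O1"
    proof (rule inj_onI)
      fix p q assume *: "p \<in> O1" "q \<in> O1" "fst p = fst q"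
      then have "\<exists>!j. (fst p, j) \<in> F \<and> f (fst p, j) = 1" using cols by (simp add: O1_def)
      moreover have "(fst p, snd p) \<in> F \<and> f (fst p, snd p) = 1" using *(1) by (simp add: O1_def)
      moreover have "(fst p, snd q) \<in> F \<and> f (fst p, snd q) = 1"
        unfolding *(3) using *(2) by (simp add: O1_def)
      ultimately show "p = q" using *(3) by (metis prod_eqI)
    qed
    show "fst ` O1 = fst ` F"
    proof (intro equalityI subsetI)
      fix i assume "i \<in> fst ` F"
      then obtain j where "(i, j) \<in> F" "f (i, j) = 1" using cols by blast
      then show "i \<in> fst ` O1" by (intro image_eqI[of _ _ "(i, j)"]) (simp_all add: O1_def)
    qed (auto simp: O1_def)
  qed
  moreover have "bij_betw snd O1 (snd ` F)"
  proof (rule bij_betw_imageI)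
    show "inj_on snd O1"
    proof (rule inj_onI)
      fix p q assume *: "p \<in> O1" "q \<in> O1" "snd p = snd q"
      then have "\<exists>!i. (i, snd p) \<in> F \<and> f (i, snd p) = 1" using rows by (simp add: O1_def)
      moreover have "(fst p, snd p) \<in> F \<and> f (fst p, snd p) = 1" using *(1) by (simp add: O1_def)
      moreover have "(fst q, snd p) \<in> F \<and> f (fst q, snd p) = 1"
        unfolding *(3) using *(2) by (simp add: O1_def)
      ultimately show "p = q" using *(3) by (metis prod_eqI)
    qed
    show "snd ` O1 = snd ` F"
    proof (intro equalityI subsetI)
      fix j assume "j \<in> snd ` F"
      then obtain i where "(i, j) \<in> F" "f (i, j) = 1" using rows by blast
      then show "j \<in> snd ` O1" by (intro image_eqI[of _ _ "(i, j)"]) (simp_all add: O1_def)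
    qed (auto simp: O1_def)
  qed
  ultimately show ?thesis by (metis bij_betw_same_card)
qed

lemma square_board_if_fillings:
  assumes F: "ferrers_board F" and "fillings F \<noteq> {}"
  shows "square_board F (card (fst ` F))"
proof
  have F': "finite F" "\<And>i j. (i, j) \<in> F \<Longrightarrow> 1 \<le> i \<and> 1 \<le> j"
    "\<And>i j i' j'. (i, j) \<in> F \<Longrightarrow> 1 \<le> i' \<Longrightarrow> i' \<le> i \<Longrightarrow> 1 \<le> j' \<Longrightarrow> j' \<le> j \<Longrightarrow> (i', j') \<in> F"
    using F unfolding ferrers_board_def by blast+
  show "fst ` F = {1..card (fst ` F)}"
  proof (rule downward_closed_eq_atLeastAtMost)
    fix i j assume "j \<in> fst ` F" "1 \<le> i" "i \<le> j"
    then obtain m where "(j, m) \<in> F" by auto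
    then have "(i, m) \<in> F" using F'(2)[of j m] F'(3)[of j m i m] \<open>1 \<le> i\<close> \<open>i \<le> j\<close> by simp
    then show "i \<in> fst ` F" by (rule image_eqI[rotated]) simp
  qed (use F'(1,2) in force)+
  have "snd ` F = {1..card (snd ` F)}"
  proof (rule downward_closed_eq_atLeastAtMost)
    fix i j assume "j \<in> snd ` F" "1 \<le> i" "i \<le> j"
    then obtain m where "(m, j) \<in> F" by auto
    then have "(m, i) \<in> F" using F'(2)[of m j] F'(3)[of m j m i] \<open>1 \<le> i\<close> \<open>i \<le> j\<close> by simp
    then show "i \<in> snd ` F" by (rule image_eqI[rotated]) simp
  qed (use F'(1,2) in force)+
  moreover obtain f where "f \<in> fillings F" using assms(2) by blast
  ultimately show "snd ` F = {1..card (fst ` F)}"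
    by (simp only: card_rows_eq_card_cols[OF \<open>f \<in> fillings F\<close>])
qed (rule F)

section \<open>Comparing the two products\<close>

theorem theorem3p2:
  fixes k a :: nat
  assumes "k \<ge> 1" and "a \<in> {1..k}"
  shows "shape_Wilf_equivalent (pop_patterns k (pop1 k a)) (pop_patterns k (pop2 k))"
  unfolding shape_Wilf_equivalent_def
proof (intro allI impI)
  fix F assume F: "ferrers_board F"
  show "card (avoiding_fillings F (pop_patterns k (pop1 k a))) =
      card (avoiding_fillings F (pop_patterns k (pop2 k)))"
  proof (cases "fillings F = {}")
    case True
    then show ?thesis by (simp add: avoiding_fillings_def)
  next
    case False
    define n where "n = card (fst ` F)"
    have sq: "square_board F n"
      unfolding n_def using F False by (rule square_board_if_fillings)
    have "card (avoiding_fillings F (pop_patterns k (pop2 k))) =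
        card (avoiding_fillings (F\<inverse>) (pop_patterns k (pop1 k 1)))"
      using card_avoiding_fillings_converse[of "pop_patterns k (pop2 k)" F]
        inv_image_pop2_patterns[OF assms(1)] by (auto simp: pop_patterns_def)
    \<comment> \<open>The product formula is used on the transposed board with position 1; it does
      not mention the position, so it can be matched with the one for \<open>a\<close>.\<close>
    also have "\<dots> = (\<Prod>r=1..n. min (card (square_board.row (F\<inverse>) r) + r - n) (k - 1))"
      using assms by (intro square_board.card_avoiding_pop1 square_board_converse sq) auto
    also have "\<dots> = (\<Prod>r=1..n. min (card (square_board.row F r) + r - n) (k - 1))"
      using prod_row_ends_converse[OF sq, of "\<lambda>t. min (t - n) (k - 1)"] by simp
    also have "\<dots> = card (avoiding_fillings F (pop_patterns k (pop1 k a)))"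
      using square_board.card_avoiding_pop1[OF sq assms(2)] by simp
    finally show ?thesis by simp
  qed
qed

end
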